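(* Let $G$ be a 2-dd with set of alternating cycles $C$. (a) If $G$ is Hamiltonian, then $G/K$ is Hamiltonian for every nonempty proper subset $K\subset C$. Conversely, if $G/K$ is Hamiltonian for some nonempty proper subset $K\subset C$, then $G$ is Hamiltonian. (b) If a nonempty proper subset $K\subset C$ has a unique open route $r$, then the minor $r{\downarrow}$ is Hamiltonian-equivalent to $G$ (i.e. $r{\downarrow}$ and $G$ are either both Hamiltonian or both non-Hamiltonian). (c) If every alternating cycle of $G$ has exactly six arcs and $G$ contains an alternating cycle of type $X^c_{2L}$ or $X^c_{1L1S}$, then $G$ is non-Hamiltonian.
   Context: Digraphs are finite; arcs are ordered pairs $(u,v)$ of vertices ($u$ the start-vertex, $v$ the end-vertex); loops are allowed. For a vertex $v$, $v_{in}$ and $v_{out}$ are the sets of arcs with end-vertex $v$, respectively start-vertex $v$ (a loop belongs to both). A 2-digraph is a digraph in which every vertex $v$ satisfies $(|v_{in}|,|v_{out}|)\in\{(2,0),(0,2),(2,2)\}$; $v$ is called an exit, entry or saturated vertex respectively. A 2-dd is a 2-digraph all of whose vertices are saturated. A 2-dd is Hamiltonian if it has a directed cycle through all its vertices. An alternating cycle (AC) of a 2-digraph is a sequence $X=(e_0,\dots,e_{2r-1})$ of $2r$ distinct arcs such that, with indices mod $2r$, $e_i$ and $e_{i+1}$ have a common end-vertex if $i$ is even and a common start-vertex if $i$ is odd; $X_f=\{e_i: i \text{ even}\}$ and $X_b=\{e_i: i\text{ odd}\}$ (which is called which is arbitrary). The arcs of a 2-digraph $G$ are uniquely partitioned into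 ACs; $C$ denotes the set of ACs. For nonempty $K\subseteq C$, $G^K$ (also written $K$) is the subgraph consisting of the arcs of the ACs in $K$ and their incident vertices; it is a 2-digraph with AC-set $K$. Entry, exit and saturated vertices of $K$ are those of $G^K$. Put $\overline K=C\setminus K$. A factor $F$ of a 2-digraph is a spanning subgraph containing exactly one arc of $v_{in}$ for each vertex $v$ with $v_{in}\ne\emptyset$ and exactly one arc of $v_{out}$ for each $v$ with $v_{out}\neq\emptyset$; it is a disjoint union of simple cycles (a loop counts as a cycle) and simple paths from entry vertices to exit vertices. $F$ is open if it contains no cycle. If the set of entry vertices is nonempty, $F$ defines a route $r_F$: the bijection from entry vertices to exit vertices sending an entry vertex $u$ to the exit vertex at which the path of $F$ starting at $u$ ends. A route is open if it is defined by an open factor. For an open route $r$ of $K$ (i.e. of $G^K$), the minor $r{\downarrow}$ is obtained from $G$ as follows: (1) delete all arcs and all saturated vertices of $G^K$; (2) for each pair $(u,v)$ with $v=r(u)$, identify $u$ and $v$ to form a new vertex $w$, preserving any in-arcs of $u$ and out-arcs of $v$ in $\overline K$ as incident arcs of $w$; (3) delete any isolated vertices. The $K$-quotient is $G/K=\{r{\downarrow} : r \text{ is an open route of } G^K\}$; $G/K$ is called Hamiltonian if it contains a Hamiltonian element. Type $X^c_{2L}$: an AC $X$ such that $G^X$ is isomorphic to the digraph on vertices $1,2,3,4$ with $X_f=\{(1,2),(2,4),(3,3)\}$ and $X_b=\{(2,2),(3,4),(1,3)\}$. Type $X^c_{1L1S}$: an AC $X$ such that $G^X$ is isomorphic to the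 digraph on vertices $1,2,3,4$ with $X_f=\{(1,2),(3,4),(2,1)\}$ and $X_b=\{(1,1),(3,2),(2,4)\}$. *)

theory Defs
  imports
    "Graph_Theory.Pair_Digraph"
    "Graph_Theory.Digraph_Isomorphism"
    "HOL-Library.FuncSet"
begin

definition two_digraph :: "'a pair_pre_digraph \<Rightarrow> bool" where
  "two_digraph H \<longleftrightarrow> pair_fin_digraph H \<and>
     (\<forall>v \<in> pverts H. (in_degree H v, out_degree H v) \<in> {(2, 0), (0, 2), (2, 2)})"

definition exits :: "'a pair_pre_digraph \<Rightarrow> 'a set" where
  "exits H = {v \<in> pverts H. (in_degree H v, out_degree H v) = (2, 0)}"

definition entries :: "'a pair_pre_digraph \<Rightarrow> 'a set" where
  "entries H = {v \<in> pverts H. (in_degree H v, out_degree H v) = (0, 2)}"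

definition saturated :: "'a pair_pre_digraph \<Rightarrow> 'a set" where
  "saturated H = {v \<in> pverts H. (in_degree H v, out_degree H v) = (2, 2)}"

definition two_dd :: "'a pair_pre_digraph \<Rightarrow> bool" where
  "two_dd H \<longleftrightarrow> two_digraph H \<and> saturated H = pverts H"

text \<open>The library notion \<^term>\<open>pre_digraph.cycle\<close> admits loops (and 2-cycles); the vertices
  of a cycle are the start-vertices of its arcs.\<close>

definition hamiltonian :: "'a pair_pre_digraph \<Rightarrow> bool" where
  "hamiltonian H \<longleftrightarrow> (\<exists>p. pre_digraph.cycle H p \<and> fst ` set p = pverts H)"

definition alt_cycle :: "'a pair_pre_digraph \<Rightarrow> ('a \<times> 'a) list \<Rightarrow> bool" where
  "alt_cycle H es \<longleftrightarrow> es \<noteq> [] \<and> even (length es) \<and> distinct es \<and> set es \<subseteq> parcs H \<and>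
     (\<forall>i < length es.
        if even i then snd (es ! i) = snd (es ! (Suc i mod length es))
        else fst (es ! i) = fst (es ! (Suc i mod length es)))"

text \<open>Sequences that differ by rotation or reversal are the same alternating cycle, so the
  members of the set \<open>C\<close> of alternating cycles, which partition the arcs, are represented by
  their arc sets.\<close>

definition alt_cycles :: "'a pair_pre_digraph \<Rightarrow> ('a \<times> 'a) set set" where
  "alt_cycles H = {set es | es. alt_cycle H es}"

text \<open>The subgraph \<open>G\<^sup>K\<close>; it depends on \<open>G\<close> only through \<open>K\<close>.\<close>

definition ac_subgraph :: "('a \<times> 'a) set set \<Rightarrow> 'a pair_pre_digraph" where
  "ac_subgraph K = \<lparr> pverts = fst ` \<Union>K \<union> snd ` \<Union>K, parcs = \<Union>K \<rparr>"

definition is_factor :: "'a pair_pre_digraph \<Rightarrow> 'a pair_pre_digraph \<Rightarrow> bool" where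
  "is_factor F H \<longleftrightarrow> spanning F H \<and>
     (\<forall>v \<in> pverts H. (in_arcs H v \<noteq> {} \<longrightarrow> in_degree F v = 1) \<and>
                     (out_arcs H v \<noteq> {} \<longrightarrow> out_degree F v = 1))"

definition is_open :: "'a pair_pre_digraph \<Rightarrow> bool" where
  "is_open F \<longleftrightarrow> \<not> (\<exists>p. pre_digraph.cycle F p)"

text \<open>Routes are maps on the entry vertices only; extensionality makes equality of routes
  insensitive to values elsewhere, which matters for uniqueness. An exit vertex has no out-arc,
  so a path of \<open>F\<close> reaching one cannot be continued.\<close>

definition defines_route ::
    "'a pair_pre_digraph \<Rightarrow> 'a pair_pre_digraph \<Rightarrow> ('a \<Rightarrow> 'a) \<Rightarrow> bool" where
  "defines_route H F r \<longleftrightarrow> entries H \<noteq> {} \<and> r \<in> extensional (entries H) \<and>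
     bij_betw r (entries H) (exits H) \<and>
     (\<forall>u \<in> entries H. \<exists>p. pre_digraph.apath F u p (r u))"

definition open_routes :: "'a pair_pre_digraph \<Rightarrow> ('a \<Rightarrow> 'a) set" where
  "open_routes H = {r. \<exists>F. is_factor F H \<and> is_open F \<and> defines_route H F r}"

text \<open>Vertices of a minor are blocks of vertices of \<open>G\<close>: the block of \<open>x\<close> is \<open>{u, r u}\<close> if
  \<open>x\<close> is \<open>u\<close> or \<open>r u\<close> for some \<open>u \<in> U\<close>, and \<open>{x}\<close> otherwise.\<close>

definition block :: "'a set \<Rightarrow> ('a \<Rightarrow> 'a) \<Rightarrow> 'a \<Rightarrow> 'a set" where
  "block U r x = {x} \<union> {r u | u. u \<in> U \<and> u = x} \<union> {u \<in> U. r u = x}"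

text \<open>In \<open>G\<close> without the arcs of \<open>G\<^sup>K\<close>, an entry vertex of \<open>G\<^sup>K\<close> has only in-arcs and an exit
  vertex only out-arcs. Hence taking images of the remaining arcs keeps exactly the in-arcs of
  \<open>u\<close> and the out-arcs of \<open>r u\<close>, and it identifies no two arcs, so that arcs of the minor are
  again just pairs.\<close>

definition minor ::
    "'a pair_pre_digraph \<Rightarrow> ('a \<times> 'a) set set \<Rightarrow> ('a \<Rightarrow> 'a) \<Rightarrow> 'a set pair_pre_digraph" where
  "minor G K r =
     (let H = ac_subgraph K;
          V = pverts G - saturated H;
          A = parcs G - parcs H;
          b = block (entries H) r;
          V' = b ` V;
          A' = map_prod b b ` A
      in \<lparr> pverts = V' - {w. \<forall>e \<in> A'. fst e \<noteq> w \<and> snd e \<noteq> w}, parcs = A' \<rparr>)"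

definition quotient ::
    "'a pair_pre_digraph \<Rightarrow> ('a \<times> 'a) set set \<Rightarrow> 'a set pair_pre_digraph set" where
  "quotient G K = minor G K ` open_routes (ac_subgraph K)"

definition hamiltonian_quotient :: "'a pair_pre_digraph \<Rightarrow> ('a \<times> 'a) set set \<Rightarrow> bool" where
  "hamiltonian_quotient G K \<longleftrightarrow> (\<exists>M \<in> quotient G K. hamiltonian M)"

text \<open>In the two model digraphs below, the arcs are written as the union of the classes
  \<open>X\<^sub>f\<close> and \<open>X\<^sub>b\<close>.\<close>

definition model_2L :: "nat pair_pre_digraph" where
  "model_2L = \<lparr> pverts = {1, 2, 3, 4},
     parcs = {(1, 2), (2, 4), (3, 3)} \<union> {(2, 2), (3, 4), (1, 3)} \<rparr>"

definition model_1L1S :: "nat pair_pre_digraph" where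
  "model_1L1S = \<lparr> pverts = {1, 2, 3, 4},
     parcs = {(1, 2), (3, 4), (2, 1)} \<union> {(1, 1), (3, 2), (2, 4)} \<rparr>"

definition type_2L :: "('a \<times> 'a) set \<Rightarrow> bool" where
  "type_2L X \<longleftrightarrow> digraph_iso (ac_subgraph {X}) model_2L"

definition type_1L1S :: "('a \<times> 'a) set \<Rightarrow> bool" where
  "type_1L1S X \<longleftrightarrow> digraph_iso (ac_subgraph {X}) model_1L1S"

end

theory Submission
  imports Defs
begin

text \<open>
  A digraph is Hamiltonian iff some single-valued set of arcs has a transitive closure relating all
  pairs of vertices. Every vertex of \<open>G\<close> has both its in-arcs in one alternating cycle, and likewise
  its out-arcs. So a Hamiltonian cycle \<open>P\<close> restricts to a factor of \<open>G\<^sup>K\<close>; it is open because a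
  cycle in it would be all of \<open>P\<close>, whereas \<open>K\<close> is proper. Contracting its paths turns \<open>P\<close> into a
  Hamiltonian cycle of the minor. Conversely, a Hamiltonian cycle of the minor of an open route
  together with the open factor defining that route is a Hamiltonian cycle of \<open>G\<close>: an open factor
  leads from every vertex of \<open>G\<^sup>K\<close> forward to an exit and backward to an entry. Part (b) is the
  case of a quotient with a single element. For (c), neither of the two special alternating
  cycles has an open factor.
\<close>

section \<open>Hamiltonicity as a relation\<close>

lemma single_valued_distinct_fst: "distinct (map fst p) \<Longrightarrow> single_valued (set p)"
  by (auto intro!: single_valuedI dest: eq_key_imp_eq_value)

lemma single_valued_distinct_snd: "distinct (map snd p) \<Longrightarrow> single_valued ((set p)\<inverse>)"
  by (rule single_valuedI) (force simp: distinct_map inj_on_def)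

lemma pcas_rtrancl: "pcas u p v \<Longrightarrow> (u, v) \<in> (set p)\<^sup>*"
proof (induction p arbitrary: u)
  case (Cons e p)
  then have "(u, snd e) \<in> set (e # p)" "(snd e, v) \<in> (set p)\<^sup>*"
    by auto
  then show ?case
    by (meson converse_rtrancl_into_rtrancl rtrancl_mono set_subset_Cons subsetD)
qed simp

lemma pcas_append: "pcas u (p @ q) v \<longleftrightarrow> (\<exists>w. pcas u p w \<and> pcas w q v)"
  by (induction p arbitrary: u) auto

text \<open>Both sides list the visited vertices in order. For a closed walk, start-vertices and
  end-vertices therefore agree with multiplicity.\<close>

lemma pcas_fst_snd: "pcas u p v \<Longrightarrow> p \<noteq> [] \<Longrightarrow> map fst p @ [v] = u # map snd p"
proof (induction p arbitrary: u)
  case (Cons e p)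
  then show ?case by (cases "p = []") auto
qed simp

text \<open>A vertex \<open>z\<close> of the closed walk is reached from \<open>u\<close> along the
  part before it, and \<open>u\<close> from \<open>z\<close> along the rest, which contains at least
  the arc leaving \<open>z\<close>. Walks are then joined at \<open>u\<close>.\<close>

lemma pcas_closed_trancl:
  assumes "pcas u p u" "x \<in> fst ` set p" "y \<in> fst ` set p"
  shows "(x, y) \<in> (set p)\<^sup>+"
proof -
  have split: "(u, z) \<in> (set p)\<^sup>* \<and> (z, u) \<in> (set p)\<^sup>+" if "z \<in> fst ` set p" for z
  proof -
    from that obtain t where "(z, t) \<in> set p" by force
    then obtain p1 p2 where p: "p = p1 @ (z, t) # p2" by (meson split_list)
    with assms(1) have "pcas u p1 z" "pcas t p2 u" by (auto simp: pcas_append)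
    then have "(u, z) \<in> (set p1)\<^sup>*" "(t, u) \<in> (set p2)\<^sup>*" by (auto dest: pcas_rtrancl)
    moreover have "set p1 \<subseteq> set p" "set p2 \<subseteq> set p" "(z, t) \<in> set p" using p by auto
    ultimately show ?thesis
      by (meson rtrancl_into_trancl2 rtrancl_mono subsetD)
  qed
  show ?thesis
    using split[OF assms(2)] split[OF assms(3)] by (meson trancl_rtrancl_trancl)
qed

lemma tl_pawalk_verts: "pcas u p v \<Longrightarrow> tl (pawalk_verts u p) = map snd p"
proof (induction p arbitrary: u)
  case (Cons e p)
  then show ?case by (cases p) auto
qed simp

section \<open>Library cycles and paths expressed through the arc relation\<close>

lemma pair_cycle_iff:
  "pre_digraph.cycle (with_proj H) p \<longleftrightarrow>
     (\<exists>u. u \<in> pverts H \<and> set p \<subseteq> parcs H \<and> pcas u p u \<and> distinct (map snd p) \<and> p \<noteq> [])"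
proof -
  have "pre_digraph.cycle (with_proj H) p \<longleftrightarrow>
     (\<exists>u. u \<in> pverts H \<and> set p \<subseteq> parcs H \<and> pcas u p u \<and>
        distinct (tl (pawalk_verts u p)) \<and> p \<noteq> [])"
    by (simp add: pre_digraph.cycle_def pre_digraph.awalk_def cas_with_proj_eq
        awalk_verts_with_proj_eq)
  then show ?thesis using tl_pawalk_verts by metis
qed

text \<open>A closed walk need not be a cycle, but it contains one. Openness of a factor thus
  becomes acyclicity of its arcs.\<close>

lemma cycle_exists_iff:
  assumes "parcs H \<subseteq> pverts H \<times> pverts H"
  shows "(\<exists>p. pre_digraph.cycle (with_proj H) p) \<longleftrightarrow> \<not> acyclic (parcs H)"
proof
  assume "\<exists>p. pre_digraph.cycle (with_proj H) p"
  then obtain u p where p: "set p \<subseteq> parcs H" "pcas u p u" "p \<noteq> []"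
    by (auto simp: pair_cycle_iff)
  then have "hd p \<in> set p" by auto
  then have "(fst (hd p), fst (hd p)) \<in> (set p)\<^sup>+"
    using p by (intro pcas_closed_trancl) auto
  then show "\<not> acyclic (parcs H)"
    using p(1) by (meson acyclic_def subsetD trancl_mono)
next
  assume "\<not> acyclic (parcs H)"
  then obtain u where u: "(u, u) \<in> (parcs H)\<^sup>+" by (auto simp: acyclic_def)
  interpret wf_digraph "with_proj H"
    using assms by unfold_locales auto
  from u obtain p where "awalk u p u" "p \<noteq> []"
    using reachable1_awalk[of u u] by auto
  then have "closed_w p" by (auto simp: closed_w_def)
  then show "\<exists>p. pre_digraph.cycle (with_proj H) p" by (rule closed_w_imp_cycle)
qed

text \<open>A walk can be shortened to a simple path, so the condition on a route becomes
  reachability. The empty path needs \<open>u\<close> to be a vertex.\<close>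

lemma apath_exists_iff:
  assumes "parcs H \<subseteq> pverts H \<times> pverts H" "u \<in> pverts H"
  shows "(\<exists>p. pre_digraph.apath (with_proj H) u p v) \<longleftrightarrow> (u, v) \<in> (parcs H)\<^sup>*"
proof -
  interpret wf_digraph "with_proj H"
    using assms by unfold_locales auto
  have "(\<exists>p. apath u p v) \<longleftrightarrow> u \<rightarrow>\<^sup>*\<^bsub>with_proj H\<^esub> v"
    by (simp add: reachable_apath)
  also have "\<dots> \<longleftrightarrow> (u, v) \<in> (parcs H)\<^sup>*"
  proof
    assume "u \<rightarrow>\<^sup>*\<^bsub>with_proj H\<^esub> v"
    then show "(u, v) \<in> (parcs H)\<^sup>*"
      by (metis reachable_neq_reachable1 rtrancl.rtrancl_refl trancl_into_rtrancl with_proj_simps(3))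
  next
    assume "(u, v) \<in> (parcs H)\<^sup>*"
    then show "u \<rightarrow>\<^sup>*\<^bsub>with_proj H\<^esub> v"
      using assms(2) reachable1_reachable[of u v]
      by (auto dest!: rtranclD simp: reachable_refl)
  qed
  finally show ?thesis .
qed

section \<open>Spanning cycles as relations\<close>

text \<open>\<open>V\<close> must be nonempty because a cycle has at least one arc, whereas for
  empty \<open>V\<close> the empty relation meets the other conditions.\<close>

definition spanning_cycle :: "'a set \<Rightarrow> 'a rel \<Rightarrow> bool" where
  "spanning_cycle V P \<longleftrightarrow>
     V \<noteq> {} \<and> single_valued P \<and> single_valued (P\<inverse>) \<and> V \<times> V \<subseteq> P\<^sup>+"

lemma hamiltonianE:
  assumes "hamiltonian H"
  obtains P where "P \<subseteq> parcs H" "spanning_cycle (pverts H) P"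
proof -
  from assms obtain p u where p: "set p \<subseteq> parcs H" "pcas u p u" "distinct (map snd p)" "p \<noteq> []"
    "fst ` set p = pverts H"
    by (auto simp: hamiltonian_def pair_cycle_iff)
  \<comment> \<open>Removing \<open>u\<close> from both vertex lists leaves equal multisets, so
    distinct end-vertices give distinct start-vertices.\<close>
  have "mset (map fst p) = mset (map snd p)"
    using arg_cong[OF pcas_fst_snd[OF p(2,4)], of mset] by simp
  then have "distinct (map fst p)" using p(3) mset_eq_imp_distinct_iff by blast
  then have "spanning_cycle (pverts H) (set p)"
    unfolding spanning_cycle_def
    using p single_valued_distinct_fst single_valued_distinct_snd
      pcas_closed_trancl[OF p(2)] by auto
  with p(1) show ?thesis by (rule that)
qed

lemma trancl_closed:
  assumes "(x, y) \<in> P\<^sup>+" "x \<in> S" "\<And>a b. (a, b) \<in> P \<Longrightarrow> a \<in> S \<Longrightarrow> b \<in> S"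
  shows "y \<in> S"
  using assms(1) by (induction) (use assms in blast)+

text \<open>\<open>P\<close> cannot be acyclic, so it contains a cycle. As \<open>P\<close> is
  single-valued, it never leaves that cycle; since everything is reachable, the cycle contains every
  vertex.\<close>

lemma hamiltonianI:
  assumes wf: "parcs H \<subseteq> pverts H \<times> pverts H"
    and P: "P \<subseteq> parcs H" "single_valued P" "pverts H \<noteq> {}" "pverts H \<times> pverts H \<subseteq> P\<^sup>+"
  shows "hamiltonian H"
proof -
  \<comment> \<open>Only the arcs of \<open>P\<close> are kept, so that the cycle found lies inside
    \<open>P\<close>.\<close>
  let ?H = "\<lparr>pverts = pverts H, parcs = P\<rparr>"
  have "\<not> acyclic P" using P(3,4) by (auto simp: acyclic_def)
  then obtain p where "pre_digraph.cycle (with_proj ?H) p"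
    using cycle_exists_iff[of ?H] wf P(1) by auto
  then obtain u where p: "set p \<subseteq> P" "u \<in> pverts H" "pcas u p u" "distinct (map snd p)" "p \<noteq> []"
    by (auto simp: pair_cycle_iff)
  then have "pre_digraph.cycle (with_proj H) p"
    unfolding pair_cycle_iff using P(1) by auto
  moreover have "fst ` set p = pverts H"
  proof
    show "fst ` set p \<subseteq> pverts H" using p(1) P(1) wf by force
    have "insert u (fst ` set p) = insert u (snd ` set p)"
      using arg_cong[OF pcas_fst_snd[OF p(3,5)], of set] by simp
    moreover have u: "u \<in> fst ` set p" using p(3,5) by (cases p) auto
    ultimately have snd_fst: "snd ` set p \<subseteq> fst ` set p" by auto
    show "pverts H \<subseteq> fst ` set p"
    proof
      fix v assume "v \<in> pverts H"
      then have "(u, v) \<in> P\<^sup>+" using p(2) P(4) by auto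
      then show "v \<in> fst ` set p"
      proof (rule trancl_closed)
        fix a b assume "(a, b) \<in> P" "a \<in> fst ` set p"
        then obtain b' where b': "(a, b') \<in> set p" by auto
        then have "b = b'" using p(1) \<open>(a, b) \<in> P\<close> P(2) by (auto dest: single_valuedD)
        then show "b \<in> fst ` set p" using b' snd_fst by force
      qed (rule u)
    qed
  qed
  ultimately show ?thesis by (auto simp: hamiltonian_def)
qed

section \<open>Contracting and lifting spanning cycles\<close>

text \<open>\<open>B\<close> plays the role of the arcs of \<open>G\<^sup>K\<close> and \<open>D\<close> that of the remaining arcs of \<open>G\<close>:
  both in-arcs of a vertex lie on the same alternating cycle, and so do both out-arcs.\<close>

locale arc_split =
  fixes B D :: "'a rel"
  assumes finite_B: "finite B"
    and Domain_disjoint: "Domain B \<inter> Domain D = {}"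
    and Range_disjoint: "Range B \<inter> Range D = {}"
    and Domain_Range: "Domain B \<union> Domain D = Range B \<union> Range D"
begin

definition vertices :: "'a set" where "vertices = Domain B \<union> Domain D"
text \<open>By the locale assumptions this equals \<open>Domain B - Range B\<close>, and
  \<open>exts\<close> equals \<open>Range B - Domain B\<close>. The intersections display the
  \<open>D\<close>-arcs that meet \<open>B\<close> there.\<close>

definition ents :: "'a set" where "ents = Domain B \<inter> Range D"
definition exts :: "'a set" where "exts = Range B \<inter> Domain D"

definition open_factor :: "'a rel \<Rightarrow> bool" where
  "open_factor f \<longleftrightarrow> f \<subseteq> B \<and> single_valued f \<and> single_valued (f\<inverse>) \<and>
     Domain f = Domain B \<and> Range f = Range B \<and> acyclic f"

definition route_of :: "'a rel \<Rightarrow> ('a \<Rightarrow> 'a) \<Rightarrow> bool" where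
  "route_of f r \<longleftrightarrow> bij_betw r ents exts \<and> (\<forall>u\<in>ents. (u, r u) \<in> f\<^sup>*)"

definition minor_arcs :: "('a \<Rightarrow> 'a) \<Rightarrow> 'a set rel" where
  "minor_arcs r = map_prod (block ents r) (block ents r) ` D"

definition minor_verts :: "('a \<Rightarrow> 'a) \<Rightarrow> 'a set set" where
  "minor_verts r = block ents r ` (Domain D \<union> Range D)"

lemma verticesI:
  "(x, y) \<in> B \<Longrightarrow> x \<in> vertices" "(x, y) \<in> B \<Longrightarrow> y \<in> vertices"
  using Domain_Range by (auto simp: vertices_def)

section \<open>Blocks and the vertices of the minor\<close>

text \<open>No value of \<open>r\<close> is again an entry and \<open>r\<close> is injective, so the
  pairs \<open>u\<close>, \<open>r u\<close> do not chain together.\<close>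

lemma block_eq_iff:
  assumes "bij_betw r ents exts"
  shows "block ents r x = block ents r y \<longleftrightarrow>
    x = y \<or> (x \<in> ents \<and> y = r x) \<or> (y \<in> ents \<and> x = r y)"
proof -
  have r: "r u \<notin> ents" "\<And>v. v \<in> ents \<Longrightarrow> r u = r v \<Longrightarrow> u = v" if "u \<in> ents" for u
  proof -
    show "r u \<notin> ents"
      using bij_betwE[OF assms] that Domain_disjoint by (auto simp: ents_def exts_def)
    show "\<And>v. v \<in> ents \<Longrightarrow> r u = r v \<Longrightarrow> u = v"
      using assms that by (auto simp: bij_betw_def inj_on_def)
  qed
  show ?thesis
  proof
    assume "block ents r x = block ents r y"
    then have "x \<in> block ents r y" by (auto simp: block_def)
    then show "x = y \<or> (x \<in> ents \<and> y = r x) \<or> (y \<in> ents \<and> x = r y)"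
      by (auto simp: block_def)
  next
    assume "x = y \<or> (x \<in> ents \<and> y = r x) \<or> (y \<in> ents \<and> x = r y)"
    then show "block ents r x = block ents r y"
      using r by (fastforce simp: block_def)
  qed
qed

text \<open>An entry lies outside \<open>Domain D\<close> and an exit outside
  \<open>Range D\<close>, so identifying them merges neither two start-vertices nor two end-vertices
  of \<open>D\<close>-arcs.\<close>

lemma block_inj:
  assumes "bij_betw r ents exts"
  shows "inj_on (block ents r) (Domain D)" "inj_on (block ents r) (Range D)"
proof -
  have "ents \<inter> Domain D = {}" "r u \<notin> Range D" if "u \<in> ents" for u
    using that bij_betwE[OF assms] Domain_disjoint Range_disjoint
    unfolding ents_def exts_def by blast+
  then show "inj_on (block ents r) (Domain D)" "inj_on (block ents r) (Range D)"
    unfolding inj_on_def block_eq_iff[OF assms] by blast+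
qed

text \<open>A vertex with \<open>D\<close>-arcs on one side only is an entry or an exit of
  \<open>B\<close>; its partner under \<open>r\<close> supplies the other side.\<close>

lemma minor_verts_eq:
  assumes "bij_betw r ents exts"
  shows "minor_verts r = block ents r ` Domain D" "minor_verts r = block ents r ` Range D"
proof -
  note iff = block_eq_iff[OF assms]
  have "block ents r x \<in> block ents r ` Domain D" if x: "x \<in> Range D" for x
  proof (cases "x \<in> ents")
    case True
    then have "r x \<in> Domain D" "block ents r x = block ents r (r x)"
      using bij_betwE[OF assms] iff by (auto simp: exts_def)
    then show ?thesis by blast
  next
    case False
    then have "x \<in> Domain D" using x Domain_Range by (simp add: ents_def) blast
    then show ?thesis by blast
  qed
  then show "minor_verts r = block ents r ` Domain D" by (auto simp: minor_verts_def)
  have "block ents r x \<in> block ents r ` Range D" if x: "x \<in> Domain D" for x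
  proof (cases "x \<in> exts")
    case True
    then obtain u where "u \<in> ents" "x = r u"
      using assms by (auto simp: bij_betw_def)
    then have "u \<in> Range D" "block ents r x = block ents r u"
      using iff by (auto simp: ents_def)
    then show ?thesis by blast
  next
    case False
    then have "x \<in> Range D" using x Domain_Range by (simp add: exts_def) blast
    then show ?thesis by blast
  qed
  then show "minor_verts r = block ents r ` Range D" by (auto simp: minor_verts_def)
qed

section \<open>Paths and routes of an open factor\<close>

text \<open>Outside \<open>Domain D\<close> the factor always offers a next arc. Being finite and
  acyclic, it cannot be followed forever, which is the well-founded induction on its
  converse.\<close>

lemma open_factor_forward:
  assumes "open_factor f" "v \<in> vertices"
  obtains x where "x \<in> Domain D" "(v, x) \<in> f\<^sup>*"
proof -
  have "finite f" using assms(1) finite_B finite_subset by (auto simp: open_factor_def)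
  then have "wf (f\<inverse>)"
    using assms(1) by (simp add: finite_acyclic_wf_converse open_factor_def)
  then have "v \<in> vertices \<longrightarrow> (\<exists>x\<in>Domain D. (v, x) \<in> f\<^sup>*)"
  proof (induction v rule: wf_induct_rule)
    case (less v)
    show ?case
    proof (cases "v \<in> Domain D")
      case False
      show ?thesis
      proof
        assume "v \<in> vertices"
        with False assms(1) obtain w where w: "(v, w) \<in> f"
          unfolding vertices_def open_factor_def by blast
        then have "w \<in> vertices" using assms(1) verticesI by (auto simp: open_factor_def)
        with less w show "\<exists>x\<in>Domain D. (v, x) \<in> f\<^sup>*"
          by (meson converse_iff converse_rtrancl_into_rtrancl)
      qed
    qed auto
  qed
  with assms(2) that show ?thesis by blast
qed

text \<open>Reversing all arcs preserves the locale assumptions and turns this into the forward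
  statement.\<close>

lemma open_factor_backward:
  assumes "open_factor f" "v \<in> vertices"
  obtains y where "y \<in> Range D" "(y, v) \<in> f\<^sup>*"
proof -
  interpret conv: arc_split "B\<inverse>" "D\<inverse>"
    using finite_B Domain_disjoint Range_disjoint Domain_Range by unfold_locales auto
  have "conv.open_factor (f\<inverse>)"
    using assms(1) by (auto simp: conv.open_factor_def open_factor_def)
  moreover have "v \<in> conv.vertices"
    using assms(2) Domain_Range by (auto simp: conv.vertices_def vertices_def)
  ultimately obtain y where "y \<in> Domain (D\<inverse>)" "(v, y) \<in> (f\<inverse>)\<^sup>*"
    by (rule conv.open_factor_forward)
  with that show ?thesis by (auto simp: rtrancl_converse)
qed

text \<open>Of two vertices reached deterministically from \<open>a\<close>, one is reachable from
  the other; but no arc of \<open>f\<close> leaves \<open>Domain D\<close>, and none enters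
  \<open>Range D\<close>.\<close>

lemma open_factor_ends_unique:
  assumes "open_factor f"
  shows "(a, x) \<in> f\<^sup>* \<Longrightarrow> (a, y) \<in> f\<^sup>* \<Longrightarrow> x \<in> Domain D \<Longrightarrow> y \<in> Domain D \<Longrightarrow> x = y"
    and "(x, a) \<in> f\<^sup>* \<Longrightarrow> (y, a) \<in> f\<^sup>* \<Longrightarrow> x \<in> Range D \<Longrightarrow> y \<in> Range D \<Longrightarrow> x = y"
proof -
  have stuck: "x = y" if "(x, y) \<in> g\<^sup>*" "x \<notin> Domain g" for g :: "'a rel" and x y
    using that by (meson Not_Domain_rtrancl)
  have f: "single_valued f" "single_valued (f\<inverse>)" "Domain f \<inter> Domain D = {}"
    "Domain (f\<inverse>) \<inter> Range D = {}"
    using assms Domain_disjoint Range_disjoint by (auto simp: open_factor_def)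
  show "x = y" if "(a, x) \<in> f\<^sup>*" "(a, y) \<in> f\<^sup>*" "x \<in> Domain D" "y \<in> Domain D"
    using single_valued_confluent[OF f(1) that(1,2)] stuck[of x y f] stuck[of y x f] that f(3)
    by blast
  show "x = y" if "(x, a) \<in> f\<^sup>*" "(y, a) \<in> f\<^sup>*" "x \<in> Range D" "y \<in> Range D"
    using single_valued_confluent[OF f(2), of a x y] stuck[of x y "f\<inverse>"] stuck[of y x "f\<inverse>"]
      that f(4)
    by (simp add: rtrancl_converse) blast
qed

text \<open>Walking back along \<open>f\<close> from the start of a \<open>B\<close>-arc ends in
  \<open>Range D\<close>, at a vertex still in \<open>Domain B\<close>. Routes are defined only when
  entries exist.\<close>

lemma ents_nonempty:
  assumes "open_factor f" "B \<noteq> {}"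
  shows "ents \<noteq> {}"
proof -
  from assms(2) obtain v w where vw: "(v, w) \<in> B" by auto
  then obtain y where y: "y \<in> Range D" "(y, v) \<in> f\<^sup>*"
    using open_factor_backward[OF assms(1)] verticesI by blast
  from y(2) have "y \<in> Domain B"
    using vw assms(1) by (cases rule: converse_rtranclE) (auto simp: open_factor_def)
  with y show ?thesis by (auto simp: ents_def)
qed

text \<open>Follow \<open>f\<close> from each entry to its end. Unique backward ends give
  injectivity, and walking back from an exit gives surjectivity.\<close>

lemma route_exists:
  assumes f: "open_factor f"
  obtains r where "r \<in> extensional ents" "route_of f r"
proof -
  have "\<exists>x\<in>exts. (u, x) \<in> f\<^sup>*" if u: "u \<in> ents" for u
  proof -
    from u have "u \<in> vertices" by (auto simp: ents_def vertices_def)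
    then obtain x where x: "x \<in> Domain D" "(u, x) \<in> f\<^sup>*"
      using open_factor_forward[OF f] by blast
    \<comment> \<open>The path is not empty, because an entry is not in \<open>Domain D\<close>; so
      \<open>x\<close> is the end of an arc of \<open>f\<close>.\<close>
    have "x \<in> Range f"
      using x(2) by (cases rule: rtranclE) (use x u Domain_disjoint in \<open>auto simp: ents_def\<close>)
    with x f show ?thesis by (auto simp: exts_def open_factor_def)
  qed
  then obtain r0 where r0: "\<And>u. u \<in> ents \<Longrightarrow> r0 u \<in> exts \<and> (u, r0 u) \<in> f\<^sup>*" by metis
  define r where "r = restrict r0 ents"
  have r: "r u \<in> exts" "(u, r u) \<in> f\<^sup>*" if "u \<in> ents" for u
    using r0 that by (auto simp: r_def)
  have "inj_on r ents"
  proof (rule inj_onI)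
    fix u v assume uv: "u \<in> ents" "v \<in> ents" "r u = r v"
    then show "u = v"
      using open_factor_ends_unique(2)[OF f r(2)[OF uv(1)]] r(2)[OF uv(2)] by (auto simp: ents_def)
  qed
  moreover have "exts \<subseteq> r ` ents"
  proof
    fix x assume x: "x \<in> exts"
    then have "x \<in> vertices" by (auto simp: exts_def vertices_def)
    then obtain y where y: "y \<in> Range D" "(y, x) \<in> f\<^sup>*"
      using open_factor_backward[OF f] by blast
    from y(2) have "y \<in> Domain f"
      by (cases rule: converse_rtranclE) (use x y Range_disjoint in \<open>auto simp: exts_def\<close>)
    with y f have "y \<in> ents" by (auto simp: ents_def open_factor_def)
    moreover have "x = r y"
      using open_factor_ends_unique(1)[OF f y(2) r(2)] r(1) x calculation by (auto simp: exts_def)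
    ultimately show "x \<in> r ` ents" by blast
  qed
  ultimately have "route_of f r" using r by (auto simp: route_of_def bij_betw_def)
  moreover have "r \<in> extensional ents" by (simp add: r_def)
  ultimately show ?thesis using that by blast
qed

section \<open>Transfer of spanning cycles between digraph and minor\<close>

text \<open>Here a \<open>D\<close>-arc arrives at \<open>y\<close> and another leaves from
  \<open>x\<close>. If they meet in the minor, then either \<open>y = x\<close> or \<open>y\<close>
  is an entry with exit \<open>x\<close>, and \<open>f\<close> fills the gap.\<close>

lemma block_eq_imp_path:
  assumes "route_of f r" "y \<in> Range D" "x \<in> Domain D" "block ents r y = block ents r x"
  shows "(y, x) \<in> f\<^sup>*"
proof -
  have r: "bij_betw r ents exts" using assms(1) by (auto simp: route_of_def)
  have "x \<notin> ents" using assms(3) Domain_disjoint by (auto simp: ents_def)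
  then have "y = x \<or> (y \<in> ents \<and> x = r y)"
    using assms(4) block_eq_iff[OF r] by auto
  then show ?thesis using assms(1) by (auto simp: route_of_def)
qed

text \<open>A nonempty path starts with an \<open>f\<close>-arc at \<open>y\<close>, so
  \<open>y\<close> is an entry, and uniqueness of forward ends forces
  \<open>x = r y\<close>.\<close>

lemma path_imp_block_eq:
  assumes f: "open_factor f" and r: "route_of f r"
    and yx: "(y, x) \<in> f\<^sup>*" "y \<in> Range D" "x \<in> Domain D"
  shows "block ents r y = block ents r x"
proof (cases "y = x")
  case False
  then have "y \<in> Domain f" using yx(1) Not_Domain_rtrancl by metis
  then have "y \<in> ents" using yx(2) f by (simp add: ents_def open_factor_def)
  moreover from this have "r y \<in> Domain D" "(y, r y) \<in> f\<^sup>*"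
    using r bij_betwE[of r ents exts] by (auto simp: route_of_def exts_def)
  then have "x = r y" using open_factor_ends_unique(1)[OF f] yx by blast
  ultimately show ?thesis using block_eq_iff r by (auto simp: route_of_def)
qed simp

text \<open>Each arc of \<open>P\<close> is replaced by its preimage in \<open>D\<close>, and
  consecutive preimages are joined by paths of \<open>f\<close>.\<close>

lemma lift_spanning_cycle:
  assumes f: "open_factor f" and r: "route_of f r"
    and P: "P \<subseteq> minor_arcs r" "single_valued P" "minor_verts r \<times> minor_verts r \<subseteq> P\<^sup>+"
  obtains Q where "Q \<subseteq> B \<union> D" "single_valued Q" "vertices \<times> vertices \<subseteq> Q\<^sup>+"
proof -
  let ?b = "block ents r"
  have bij: "bij_betw r ents exts" using r by (auto simp: route_of_def)
  define Q where "Q = f \<union> {e \<in> D. map_prod ?b ?b e \<in> P}"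
  have f_Q: "f \<subseteq> Q" by (auto simp: Q_def)
  \<comment> \<open>The preimage in \<open>D\<close> is determined by its ends, since
    \<open>block\<close> is injective on each side of \<open>D\<close>.\<close>
  have lift: "(x, y) \<in> Q" if "(?b x, ?b y) \<in> P" "x \<in> Domain D" "y \<in> Range D" for x y
  proof -
    from that(1) P(1) obtain x' y' where d: "(x', y') \<in> D" "?b x = ?b x'" "?b y = ?b y'"
      by (auto simp: minor_arcs_def)
    then have "x = x'" "y = y'"
      using inj_onD[OF block_inj(1)[OF bij]] inj_onD[OF block_inj(2)[OF bij]] that by blast+
    with d that show ?thesis by (auto simp: Q_def)
  qed
  have path: "(x, y) \<in> Q\<^sup>+" if "(?b x, w) \<in> P\<^sup>+" "w = ?b y" "x \<in> Domain D" "y \<in> Range D" for x y w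
    using that
  proof (induction arbitrary: y rule: trancl_induct)
    case (base w)
    then show ?case using lift by blast
  next
    \<comment> \<open>The middle block has two representatives: \<open>y1\<close>, where the
      previous arc arrives, and \<open>x1\<close>, where the next one leaves; \<open>f\<close> leads
      from the first to the second.\<close>
    case (step w w')
    from step.hyps(2) P(1) obtain x1 where x1: "x1 \<in> Domain D" "w = ?b x1"
      unfolding minor_arcs_def by fastforce
    from step.hyps(1) obtain w0 where "(w0, w) \<in> P" by (meson tranclE)
    with P(1) obtain y1 where y1: "y1 \<in> Range D" "w = ?b y1"
      unfolding minor_arcs_def by fastforce
    have "(x, y1) \<in> Q\<^sup>+" using step y1 by blast
    moreover have "(y1, x1) \<in> Q\<^sup>*"
      using block_eq_imp_path[OF r y1(1) x1(1)] x1 y1 f_Q rtrancl_mono by blast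
    moreover have "(x1, y) \<in> Q" using lift step x1 by blast
    ultimately show ?case by (meson rtrancl_into_trancl1 trancl_into_rtrancl trancl_rtrancl_trancl)
  qed
  have "Q \<subseteq> B \<union> D" using f by (auto simp: Q_def open_factor_def)
  moreover have "single_valued Q"
  proof (rule single_valuedI)
    fix x y z assume xy: "(x, y) \<in> Q" "(x, z) \<in> Q"
    show "y = z"
    proof (cases "x \<in> Domain B")
      case True
      then have "(x, y) \<in> f" "(x, z) \<in> f" using xy Domain_disjoint by (auto simp: Q_def)
      then show ?thesis using f by (auto simp: open_factor_def dest: single_valuedD)
    next
      case False
      then have "(x, y) \<notin> f" "(x, z) \<notin> f" using f by (auto simp: open_factor_def)
      then have "(x, y) \<in> D" "(x, z) \<in> D" "(?b x, ?b y) \<in> P" "(?b x, ?b z) \<in> P"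
        using xy by (auto simp: Q_def)
      then have "?b y = ?b z" "y \<in> Range D" "z \<in> Range D"
        using single_valuedD[OF P(2)] by auto
      then show ?thesis by (rule inj_onD[OF block_inj(2)[OF bij]])
    qed
  qed
  \<comment> \<open>From \<open>v\<close>, \<open>f\<close> leads forward to a start of
    \<open>D\<close>-arcs, and \<open>w\<close> is reached by \<open>f\<close> from an end of
    \<open>D\<close>-arcs; between these the lifted walk applies.\<close>
  moreover have "(v, w) \<in> Q\<^sup>+" if vw: "v \<in> vertices" "w \<in> vertices" for v w
  proof -
    obtain x where x: "x \<in> Domain D" "(v, x) \<in> f\<^sup>*" using open_factor_forward[OF f vw(1)] .
    obtain y where y: "y \<in> Range D" "(y, w) \<in> f\<^sup>*" using open_factor_backward[OF f vw(2)] .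
    have "?b x \<in> minor_verts r" "?b y \<in> minor_verts r"
      using x(1) y(1) unfolding minor_verts_def by blast+
    then have "(?b x, ?b y) \<in> P\<^sup>+" using P(3) by blast
    then have "(x, y) \<in> Q\<^sup>+" using path x y by blast
    moreover have "(v, x) \<in> Q\<^sup>*" "(y, w) \<in> Q\<^sup>*" using x y f_Q rtrancl_mono by blast+
    ultimately show ?thesis by (meson rtrancl_trancl_trancl trancl_rtrancl_trancl)
  qed
  ultimately show ?thesis using that by blast
qed

text \<open>\<open>P\<close> leaves and enters every vertex, and at vertices of
  \<open>Domain B\<close> or \<open>Range B\<close> it can do so only by \<open>B\<close>-arcs. A
  cycle within \<open>B\<close> would trap \<open>P\<close> away from \<open>D\<close>.\<close>

lemma open_factor_of_spanning_cycle:
  assumes P: "P \<subseteq> B \<union> D" "spanning_cycle vertices P" and "D \<noteq> {}"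
  shows "open_factor (P \<inter> B)"
proof -
  have sv: "single_valued P" "single_valued (P\<inverse>)" "vertices \<times> vertices \<subseteq> P\<^sup>+"
    using P(2) by (auto simp: spanning_cycle_def)
  have "Domain (P \<inter> B) = Domain B"
  proof
    show "Domain B \<subseteq> Domain (P \<inter> B)"
    proof
      fix v assume v: "v \<in> Domain B"
      then have "(v, v) \<in> P\<^sup>+" using sv(3) by (auto simp: vertices_def)
      then obtain w where "(v, w) \<in> P" by (meson converse_tranclE)
      then show "v \<in> Domain (P \<inter> B)" using P(1) v Domain_disjoint by auto
    qed
  qed auto
  moreover have "Range (P \<inter> B) = Range B"
  proof
    show "Range B \<subseteq> Range (P \<inter> B)"
    proof
      fix v assume v: "v \<in> Range B"
      then have "(v, v) \<in> P\<^sup>+" using sv(3) Domain_Range by (auto simp: vertices_def)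
      then obtain w where "(w, v) \<in> P" by (meson tranclE)
      then show "v \<in> Range (P \<inter> B)" using P(1) v Range_disjoint by auto
    qed
  qed auto
  moreover have "acyclic (P \<inter> B)"
  proof (rule acyclicI, intro allI notI)
    fix x assume x: "(x, x) \<in> (P \<inter> B)\<^sup>+"
    from \<open>D \<noteq> {}\<close> obtain d where d: "d \<in> Domain D" by auto
    from x have "x \<in> Domain B" by (auto elim: converse_tranclE)
    then have "(x, d) \<in> P\<^sup>+" using sv(3) d by (auto simp: vertices_def)
    \<comment> \<open>The vertices leading to \<open>x\<close> inside \<open>P \<inter> B\<close>
      are closed under \<open>P\<close>: the only \<open>P\<close>-arc from such a vertex is the
      first arc of its path to \<open>x\<close>, and \<open>x\<close> itself returns to
      \<open>x\<close>.\<close>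
    then have "d \<in> {y. (y, x) \<in> (P \<inter> B)\<^sup>+}"
    proof (rule trancl_closed)
      fix a b assume ab: "(a, b) \<in> P" "a \<in> {y. (y, x) \<in> (P \<inter> B)\<^sup>+}"
      then obtain b' where b': "(a, b') \<in> P \<inter> B" "(b', x) \<in> (P \<inter> B)\<^sup>*"
        by (auto dest: tranclD)
      then have "b = b'" using ab sv(1) by (auto dest: single_valuedD)
      with b' x show "b \<in> {y. (y, x) \<in> (P \<inter> B)\<^sup>+}"
        by auto
    qed (simp add: x)
    then have "d \<in> Domain B" by (auto elim: converse_tranclE)
    with d Domain_disjoint show False by auto
  qed
  moreover have "single_valued (P \<inter> B)" "single_valued ((P \<inter> B)\<inverse>)"
    using sv(1,2) by (auto simp: single_valued_def)
  ultimately show ?thesis by (simp add: open_factor_def)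
qed

text \<open>The images of the \<open>D\<close>-arcs of \<open>P\<close> form the cycle, since each
  stretch of \<open>B\<close>-arcs between them collapses to one block.\<close>

lemma contract_spanning_cycle:
  assumes P: "P \<subseteq> B \<union> D" "spanning_cycle vertices P"
    and f: "open_factor (P \<inter> B)" and r: "route_of (P \<inter> B) r"
  obtains Q where "Q \<subseteq> minor_arcs r" "single_valued Q" "minor_verts r \<times> minor_verts r \<subseteq> Q\<^sup>+"
proof -
  let ?b = "block ents r" and ?f = "P \<inter> B"
  have sv: "single_valued P" "single_valued (P\<inverse>)" "vertices \<times> vertices \<subseteq> P\<^sup>+"
    using P(2) by (auto simp: spanning_cycle_def)
  have bij: "bij_betw r ents exts" using r by (auto simp: route_of_def)
  define Q where "Q = map_prod ?b ?b ` (P \<inter> D)"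
  \<comment> \<open>Invariant of a walk along \<open>P\<close>: \<open>y\<close> is the end of its
    last \<open>D\<close>-arc, only factor arcs have followed, and the walk in the minor stands at
    the block of \<open>y\<close>.\<close>
  have path: "\<exists>y\<in>Range D. (y, z) \<in> ?f\<^sup>* \<and> (?b x, ?b y) \<in> Q\<^sup>+"
    if "(x, z) \<in> P\<^sup>+" "x \<in> Domain D" for x z
    using that
  proof (induction rule: trancl_induct)
    case (base z)
    then have "(x, z) \<in> P \<inter> D" using P(1) Domain_disjoint by auto
    then have "z \<in> Range D" "(?b x, ?b z) \<in> Q" by (auto simp: Q_def)
    then show ?case by blast
  next
    case (step z z')
    then obtain y where y: "y \<in> Range D" "(y, z) \<in> ?f\<^sup>*" "(?b x, ?b y) \<in> Q\<^sup>+" by auto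
    show ?case
    proof (cases "(z, z') \<in> B")
      case True
      with y step show ?thesis by (auto intro: rtrancl_into_rtrancl)
    next
      case False
      then have z: "(z, z') \<in> P \<inter> D" using step P(1) by auto
      then have "?b y = ?b z" using path_imp_block_eq[OF f r y(2,1)] by auto
      moreover have "(?b z, ?b z') \<in> Q" using z by (auto simp: Q_def)
      ultimately show ?thesis using y(3) z by (metis IntD2 Range_iff rtrancl.rtrancl_refl trancl_into_trancl)
    qed
  qed
  have "Q \<subseteq> minor_arcs r" by (auto simp: Q_def minor_arcs_def)
  moreover have "single_valued Q"
  proof (rule single_valuedI)
    fix w w1 w2 assume "(w, w1) \<in> Q" "(w, w2) \<in> Q"
    then obtain x1 y1 x2 y2 where *: "(x1, y1) \<in> P \<inter> D" "(x2, y2) \<in> P \<inter> D"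
      "?b x1 = ?b x2" "w1 = ?b y1" "w2 = ?b y2"
      by (auto simp: Q_def)
    then have "x1 = x2" using inj_onD[OF block_inj(1)[OF bij]] by blast
    with * show "w1 = w2" using sv(1) by (auto dest: single_valuedD)
  qed
  moreover have "(w, w') \<in> Q\<^sup>+" if w: "w \<in> minor_verts r" "w' \<in> minor_verts r" for w w'
  proof -
    obtain x where x: "x \<in> Domain D" "w = ?b x" using w(1) minor_verts_eq(1)[OF bij] by auto
    obtain z where z: "z \<in> Range D" "w' = ?b z" using w(2) minor_verts_eq(2)[OF bij] by auto
    have "(x, z) \<in> P\<^sup>+" using sv(3) x z Domain_Range unfolding vertices_def by blast
    then obtain y where y: "y \<in> Range D" "(y, z) \<in> ?f\<^sup>*" "(?b x, ?b y) \<in> Q\<^sup>+"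
      using path x by blast
    \<comment> \<open>No factor arc enters \<open>Range D\<close>, so the pending stretch is
      empty.\<close>
    have "y = z" using open_factor_ends_unique(2)[OF f y(2)] y z by blast
    with y x z show ?thesis by simp
  qed
  ultimately show ?thesis using that by blast
qed

end

section \<open>Alternating cycles, factors and minors\<close>

lemma card_fibre_fst_iff:
  assumes "f \<subseteq> B"
  shows "(\<forall>v\<in>Domain B. card {e \<in> f. fst e = v} = 1) \<longleftrightarrow> single_valued f \<and> Domain f = Domain B"
proof
  assume *: "\<forall>v\<in>Domain B. card {e \<in> f. fst e = v} = 1"
  have "\<exists>w. {e \<in> f. fst e = v} = {(v, w)}" if v: "v \<in> Domain B" for v
  proof -
    from * v obtain e where e: "{e \<in> f. fst e = v} = {e}" by (meson card_1_singletonE)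
    then have "fst e = v" by blast
    with e show ?thesis by (metis prod.collapse)
  qed
  then obtain g where g: "\<And>v. v \<in> Domain B \<Longrightarrow> {e \<in> f. fst e = v} = {(v, g v)}" by metis
  have "w = g v" if "(v, w) \<in> f" for v w
  proof -
    from that assms have v: "v \<in> Domain B" by blast
    from that have "(v, w) \<in> {e \<in> f. fst e = v}" by simp
    then show ?thesis unfolding g[OF v] by simp
  qed
  moreover have "(v, g v) \<in> f" if "v \<in> Domain B" for v
    using g[OF that] by blast
  ultimately show "single_valued f \<and> Domain f = Domain B"
    using assms unfolding single_valued_def by blast
next
  assume *: "single_valued f \<and> Domain f = Domain B"
  show "\<forall>v\<in>Domain B. card {e \<in> f. fst e = v} = 1"
  proof
    fix v assume "v \<in> Domain B"
    with * obtain w where "(v, w) \<in> f" by blast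
    with * have "{e \<in> f. fst e = v} = {(v, w)}" by (auto dest: single_valuedD)
    then show "card {e \<in> f. fst e = v} = 1" by simp
  qed
qed

lemma card_fibre_snd_iff:
  assumes "f \<subseteq> B"
  shows "(\<forall>v\<in>Range B. card {e \<in> f. snd e = v} = 1) \<longleftrightarrow> single_valued (f\<inverse>) \<and> Range f = Range B"
proof -
  have "card {e \<in> f\<inverse>. fst e = v} = card {e \<in> f. snd e = v}" for v
    by (rule bij_betw_same_card[of prod.swap]) (force simp: bij_betw_def inj_on_def image_iff)
  then show ?thesis
    using card_fibre_fst_iff[of "f\<inverse>" "B\<inverse>"] assms by (simp add: converse_mono)
qed

section \<open>Alternating cycles as closed sets of arcs\<close>

text \<open>This forgets the cyclic order. In a 2-dd an alternating cycle is closed in this sense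
  and lies inside every closed set that it meets.\<close>

definition alternation_closed :: "'a rel \<Rightarrow> 'a rel \<Rightarrow> bool" where
  "alternation_closed A S \<longleftrightarrow> S \<subseteq> A \<and>
     (\<forall>e\<in>S. \<forall>e'\<in>A. fst e = fst e' \<or> snd e = snd e' \<longrightarrow> e' \<in> S)"

lemma alternation_closedD:
  assumes "alternation_closed A S"
  shows "S \<subseteq> A" "e \<in> S \<Longrightarrow> e' \<in> A \<Longrightarrow> fst e = fst e' \<or> snd e = snd e' \<Longrightarrow> e' \<in> S"
  using assms unfolding alternation_closed_def by blast+

lemma alt_cycle_next:
  assumes "alt_cycle H es" "i < length es"
  shows "Suc i mod length es < length es" "es ! (Suc i mod length es) \<noteq> es ! i"
proof -
  have len: "length es \<noteq> 0" "even (length es)" "distinct es"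
    using assms by (auto simp: alt_cycle_def)
  then show *: "Suc i mod length es < length es" by simp
  have "Suc i mod length es \<noteq> i"
    using len assms(2) by (cases i; cases "Suc i = length es") auto
  with * len(3) assms(2) show "es ! (Suc i mod length es) \<noteq> es ! i"
    by (simp add: nth_eq_iff_index_eq)
qed

text \<open>Parity alternates also at the wrap-around: the predecessor of index 0 is the last index,
  which is odd because the length is even.\<close>

lemma alt_cycle_prev:
  assumes "alt_cycle H es" "i < length es"
  obtains j where "j < length es" "Suc j mod length es = i" "even j \<longleftrightarrow> odd i"
proof (cases i)
  case 0
  with assms that[of "length es - 1"] show ?thesis
    by (auto simp: alt_cycle_def)
next
  case (Suc j)
  with assms that[of j] show ?thesis by auto
qed

text \<open>Of the two cyclic neighbours of an arc, one shares its end-vertex and the other its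
  start-vertex.\<close>

lemma alt_cycle_twin:
  assumes "alt_cycle H es" "e \<in> set es"
  shows "\<exists>e'\<in>set es. e' \<noteq> e \<and> snd e' = snd e" "\<exists>e'\<in>set es. e' \<noteq> e \<and> fst e' = fst e"
proof -
  obtain i where i: "i < length es" "e = es ! i"
    using assms(2) by (auto simp: in_set_conv_nth)
  obtain j where j: "j < length es" "Suc j mod length es = i" "even j \<longleftrightarrow> odd i"
    using alt_cycle_prev[OF assms(1) i(1)] .
  have step: "if even k then snd (es ! k) = snd (es ! (Suc k mod length es))
      else fst (es ! k) = fst (es ! (Suc k mod length es))" if "k < length es" for k
    using assms(1) that by (simp add: alt_cycle_def)
  note n = alt_cycle_next[OF assms(1) i(1)] and p = alt_cycle_next[OF assms(1) j(1)]
  show "\<exists>e'\<in>set es. e' \<noteq> e \<and> snd e' = snd e"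
    using step[OF i(1)] step[OF j(1)] n p i j by (cases "even i") (metis nth_mem)+
  show "\<exists>e'\<in>set es. e' \<noteq> e \<and> fst e' = fst e"
    using step[OF i(1)] step[OF j(1)] n p i j by (cases "even i") (metis nth_mem)+
qed

lemma alt_cycle_subset_closed:
  assumes es: "alt_cycle H es" and S: "alternation_closed (parcs H) S" and "set es \<inter> S \<noteq> {}"
  shows "set es \<subseteq> S"
proof
  let ?n = "length es"
  from assms(3) obtain k where k: "k < ?n" "es ! k \<in> S"
    by (metis disjoint_iff in_set_conv_nth)
  have step: "es ! (Suc i mod ?n) \<in> S" if "i < ?n" "es ! i \<in> S" for i
  proof -
    have "es ! (Suc i mod ?n) \<in> parcs H"
      using es nth_mem[OF alt_cycle_next(1)[OF es that(1)]] unfolding alt_cycle_def by blast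
    moreover have "snd (es ! i) = snd (es ! (Suc i mod ?n)) \<or>
        fst (es ! i) = fst (es ! (Suc i mod ?n))"
      using es that(1) unfolding alt_cycle_def by metis
    ultimately show ?thesis using alternation_closedD(2)[OF S that(2)] by blast
  qed
  have all: "es ! ((k + m) mod ?n) \<in> S" for m
  proof (induction m)
    case (Suc m)
    have "(k + m) mod ?n < ?n" using k(1) by (intro mod_less_divisor) linarith
    with step[of "(k + m) mod ?n"] Suc show ?case by (simp add: mod_Suc_eq)
  qed (use k in simp)
  fix e assume "e \<in> set es"
  then obtain i where i: "i < ?n" "e = es ! i" by (auto simp: in_set_conv_nth)
  \<comment> \<open>This offset leads from position \<open>k\<close> around the cycle to position
    \<open>i\<close>, whichever comes first.\<close>
  have "(k + (?n - k + i)) mod ?n = i" using k(1) i(1) by simp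
  with all[of "?n - k + i"] i show "e \<in> S" by simp
qed

lemma two_ddD:
  assumes "two_dd G"
  shows "finite (parcs G)" "parcs G \<subseteq> pverts G \<times> pverts G"
    "v \<in> pverts G \<Longrightarrow> card {e \<in> parcs G. snd e = v} = 2"
    "v \<in> pverts G \<Longrightarrow> card {e \<in> parcs G. fst e = v} = 2"
proof -
  interpret pair_fin_digraph G
    using assms by (simp add: two_dd_def two_digraph_def)
  show "finite (parcs G)" "parcs G \<subseteq> pverts G \<times> pverts G"
    using pair_finite_arcs wellformed' by auto
  show "card {e \<in> parcs G. snd e = v} = 2" "card {e \<in> parcs G. fst e = v} = 2"
    if "v \<in> pverts G"
  proof -
    have "v \<in> saturated G" using assms that by (simp add: two_dd_def)
    then show "card {e \<in> parcs G. snd e = v} = 2" "card {e \<in> parcs G. fst e = v} = 2"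
      by (auto simp: saturated_def in_degree_def out_degree_def in_arcs_def out_arcs_def)
  qed
qed

lemma two_dd_Domain_Range:
  assumes "two_dd G"
  shows "Domain (parcs G) = pverts G" "Range (parcs G) = pverts G"
proof -
  have "{e \<in> parcs G. fst e = v} \<noteq> {}" "{e \<in> parcs G. snd e = v} \<noteq> {}" if "v \<in> pverts G" for v
    using two_ddD(3,4)[OF assms that] by (metis card.empty zero_neq_numeral)+
  then show "Domain (parcs G) = pverts G" "Range (parcs G) = pverts G"
    using two_ddD(2)[OF assms] by (fastforce simp: Domain_fst Range_snd)+
qed

lemma card_two_mem:
  assumes "card S = 2" "a \<in> S" "b \<in> S" "a \<noteq> b" "c \<in> S"
  shows "c = a \<or> c = b"
  using assms by (auto simp: card_2_iff)

text \<open>A vertex has just two in-arcs and two out-arcs, and the twin of an arc within the cycle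
  already is the second one.\<close>

lemma alt_cycles_closed:
  assumes "two_dd G" "X \<in> alt_cycles G"
  shows "alternation_closed (parcs G) X" "X \<noteq> {}"
proof -
  from assms(2) obtain es where es: "alt_cycle G es" "X = set es"
    by (auto simp: alt_cycles_def)
  then show "X \<noteq> {}" by (auto simp: alt_cycle_def)
  have sub: "X \<subseteq> parcs G" using es by (auto simp: alt_cycle_def)
  have "e' \<in> X" if e: "e \<in> X" "e' \<in> parcs G" "fst e = fst e'" for e e'
  proof -
    obtain d where d: "d \<in> X" "d \<noteq> e" "fst d = fst e"
      using alt_cycle_twin(2)[OF es(1)] es(2) e(1) by blast
    have "fst e \<in> pverts G" using two_ddD(2)[OF assms(1)] sub e(1) by force
    from card_two_mem[OF two_ddD(4)[OF assms(1) this], of e d e'] d e sub show ?thesis by auto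
  qed
  moreover have "e' \<in> X" if e: "e \<in> X" "e' \<in> parcs G" "snd e = snd e'" for e e'
  proof -
    obtain d where d: "d \<in> X" "d \<noteq> e" "snd d = snd e"
      using alt_cycle_twin(1)[OF es(1)] es(2) e(1) by blast
    have "snd e \<in> pverts G" using two_ddD(2)[OF assms(1)] sub e(1) by force
    from card_two_mem[OF two_ddD(3)[OF assms(1) this], of e d e'] d e sub show ?thesis by auto
  qed
  ultimately show "alternation_closed (parcs G) X"
    using sub unfolding alternation_closed_def by blast
qed

lemma alt_cycles_disjoint:
  assumes "two_dd G" "X \<in> alt_cycles G" "Y \<in> alt_cycles G" "X \<inter> Y \<noteq> {}"
  shows "X = Y"
proof -
  from assms(2,3) obtain es es' where es: "alt_cycle G es" "X = set es" "alt_cycle G es'" "Y = set es'"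
    by (auto simp: alt_cycles_def)
  have "X \<subseteq> Y"
    using alt_cycle_subset_closed[OF es(1) alt_cycles_closed(1)[OF assms(1,3)]] es assms(4) by auto
  moreover have "Y \<subseteq> X"
    using alt_cycle_subset_closed[OF es(3) alt_cycles_closed(1)[OF assms(1,2)]] es assms(4) by auto
  ultimately show ?thesis by blast
qed

section \<open>Splitting a 2-dd along a set of alternating cycles\<close>

locale two_dd_split =
  fixes G :: "'a pair_pre_digraph" and K :: "('a \<times> 'a) set set"
  assumes two_dd: "two_dd G"
    and K_nonempty: "K \<noteq> {}"
    and K_proper: "K \<subset> alt_cycles G"
begin

definition B :: "'a rel" where "B = \<Union>K"
definition D :: "'a rel" where "D = parcs G - B"

lemma B_subset: "B \<subseteq> parcs G"
  and B_parallel: "e \<in> B \<Longrightarrow> e' \<in> parcs G \<Longrightarrow> fst e = fst e' \<or> snd e = snd e' \<Longrightarrow> e' \<in> B"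
  using alternation_closedD[OF alt_cycles_closed(1)[OF two_dd]] K_proper
  unfolding B_def by blast+

lemma parcs_eq: "parcs G = B \<union> D"
  using B_subset by (auto simp: D_def)

lemma B_nonempty: "B \<noteq> {}"
  using K_nonempty K_proper alt_cycles_closed(2)[OF two_dd] unfolding B_def by blast

text \<open>Properness of \<open>K\<close> leaves an alternating cycle outside it, which is disjoint
  from all members of \<open>K\<close>.\<close>

lemma D_nonempty: "D \<noteq> {}"
proof -
  from K_proper obtain X where X: "X \<in> alt_cycles G" "X \<notin> K" by auto
  then obtain e where e: "e \<in> X" using alt_cycles_closed(2)[OF two_dd] by blast
  have "e \<notin> B"
    using X e alt_cycles_disjoint[OF two_dd X(1)] K_proper unfolding B_def by blast
  moreover have "e \<in> parcs G"
    using e alternation_closedD(1)[OF alt_cycles_closed(1)[OF two_dd X(1)]] by blast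
  ultimately show ?thesis unfolding D_def by blast
qed

text \<open>\<open>B\<close> contains every arc sharing a start or an end with one of its arcs,
  which gives disjointness; the two unions agree because every vertex of a 2-dd has in-arcs and
  out-arcs.\<close>

sublocale arc_split B D
proof
  show "finite B" using B_subset two_ddD(1)[OF two_dd] finite_subset by blast
  have "(x, z) \<notin> D" "(z, y) \<notin> D" if "(x, y) \<in> B" for x y z
    using B_parallel[OF that, of "(x, z)"] B_parallel[OF that, of "(z, y)"] by (auto simp: D_def)
  then show "Domain B \<inter> Domain D = {}" "Range B \<inter> Range D = {}"
    by blast+
  show "Domain B \<union> Domain D = Range B \<union> Range D"
    using two_dd_Domain_Range[OF two_dd] unfolding parcs_eq by blast
qed

lemma vertices_eq: "vertices = pverts G"
  unfolding vertices_def using two_dd_Domain_Range[OF two_dd] unfolding parcs_eq by blast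

abbreviation H :: "'a pair_pre_digraph" where "H \<equiv> ac_subgraph K"

lemma parcs_H: "parcs H = B" and pverts_H: "pverts H = Domain B \<union> Range B"
  by (auto simp: ac_subgraph_def B_def Domain_fst Range_snd)

text \<open>\<open>B\<close> contains both in-arcs of a vertex or neither, and likewise for
  out-arcs.\<close>

lemma H_degrees:
  "in_degree H v = (if v \<in> Range B then 2 else 0)"
  "out_degree H v = (if v \<in> Domain B then 2 else 0)"
proof -
  have deg: "in_degree H v = card {e \<in> B. snd e = v}" "out_degree H v = card {e \<in> B. fst e = v}"
    by (simp_all add: in_degree_def out_degree_def in_arcs_def out_arcs_def parcs_H)
  show "in_degree H v = (if v \<in> Range B then 2 else 0)"
  proof (cases "v \<in> Range B")
    case True
    then obtain w where w: "(w, v) \<in> B" by blast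
    then have "{e \<in> B. snd e = v} = {e \<in> parcs G. snd e = v}"
      using B_parallel[OF w] B_subset by auto
    moreover have "v \<in> pverts G"
      using w two_dd_Domain_Range[OF two_dd] B_subset by blast
    ultimately show ?thesis using two_ddD(3)[OF two_dd] True unfolding deg by simp
  next
    case False
    then have "{e \<in> B. snd e = v} = {}" by force
    with False show ?thesis unfolding deg by (simp only: if_False card.empty)
  qed
  show "out_degree H v = (if v \<in> Domain B then 2 else 0)"
  proof (cases "v \<in> Domain B")
    case True
    then obtain w where w: "(v, w) \<in> B" by blast
    then have "{e \<in> B. fst e = v} = {e \<in> parcs G. fst e = v}"
      using B_parallel[OF w] B_subset by auto
    moreover have "v \<in> pverts G"
      using w two_dd_Domain_Range[OF two_dd] B_subset by blast
    ultimately show ?thesis using two_ddD(4)[OF two_dd] True unfolding deg by simp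
  next
    case False
    then have "{e \<in> B. fst e = v} = {}" by force
    with False show ?thesis unfolding deg by (simp only: if_False card.empty)
  qed
qed

lemma H_special_verts:
  "entries H = ents" "exits H = exts" "pverts G - saturated H = Domain D \<union> Range D"
proof -
  have "entries H = Domain B - Range B"
    unfolding entries_def H_degrees pverts_H set_eq_iff by (auto split: if_splits)
  moreover have "exits H = Range B - Domain B"
    unfolding exits_def H_degrees pverts_H set_eq_iff by (auto split: if_splits)
  moreover have "saturated H = Domain B \<inter> Range B"
    unfolding saturated_def H_degrees pverts_H set_eq_iff by (auto split: if_splits)
  moreover have "Domain B \<union> Domain D = pverts G" "Range B \<union> Range D = pverts G"
    using two_dd_Domain_Range[OF two_dd] unfolding parcs_eq by blast+
  \<comment> \<open>Used with \<open>S\<close>, \<open>S'\<close> the domains and \<open>T\<close>,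
    \<open>T'\<close> the ranges of \<open>B\<close> and \<open>D\<close>, which are complementary
    in the vertex set.\<close>
  moreover have "S - T = S \<inter> T'" "T - S = T \<inter> S'" "V - S \<inter> T = S' \<union> T'"
    if "S \<union> S' = V" "T \<union> T' = V" "S \<inter> S' = {}" "T \<inter> T' = {}" for S S' T T' V :: "'a set"
    using that by auto
  ultimately show "entries H = ents" "exits H = exts"
      "pverts G - saturated H = Domain D \<union> Range D"
    using Domain_disjoint Range_disjoint by (simp_all only: ents_def exts_def)
qed

lemma minor_eq:
  "pverts (minor G K r) = minor_verts r" "parcs (minor G K r) = minor_arcs r"
proof -
  show "parcs (minor G K r) = minor_arcs r"
    by (simp add: minor_def Let_def minor_arcs_def H_special_verts parcs_H D_def[symmetric])
  \<comment> \<open>Every block comes from an end of a \<open>D\<close>-arc, so the removal of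
    isolated vertices removes nothing.\<close>
  have "\<exists>e\<in>minor_arcs r. fst e = w \<or> snd e = w" if w: "w \<in> minor_verts r" for w
  proof -
    from w obtain x y where "(x, y) \<in> D" "w = block ents r x \<or> w = block ents r y"
      by (auto simp: minor_verts_def)
    then show ?thesis
      unfolding minor_arcs_def by (intro bexI[of _ "map_prod (block ents r) (block ents r) (x, y)"]) auto
  qed
  then have "minor_verts r - {w. \<forall>e\<in>minor_arcs r. fst e \<noteq> w \<and> snd e \<noteq> w} = minor_verts r"
    by blast
  then show "pverts (minor G K r) = minor_verts r"
    by (simp add: minor_def Let_def minor_arcs_def minor_verts_def H_special_verts parcs_H
        D_def[symmetric])
qed

lemma minor_wf: "parcs (minor G K r) \<subseteq> pverts (minor G K r) \<times> pverts (minor G K r)"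
  unfolding minor_eq by (force simp: minor_verts_def minor_arcs_def)

lemma is_factor_iff:
  "is_factor F H \<longleftrightarrow> pverts F = pverts H \<and> parcs F \<subseteq> B \<and>
     single_valued (parcs F) \<and> single_valued ((parcs F)\<inverse>) \<and>
     Domain (parcs F) = Domain B \<and> Range (parcs F) = Range B"
proof -
  have "spanning (with_proj F) (with_proj H) \<longleftrightarrow> pverts F = pverts H \<and> parcs F \<subseteq> B"
    unfolding spanning_def subgraph_def compatible_def wf_digraph_def
    by (auto simp: parcs_H pverts_H)
  moreover have "(\<forall>v\<in>pverts H. (in_arcs H v \<noteq> {} \<longrightarrow> in_degree F v = 1) \<and>
                     (out_arcs H v \<noteq> {} \<longrightarrow> out_degree F v = 1)) \<longleftrightarrow>
      (\<forall>v\<in>Domain B. card {e \<in> parcs F. fst e = v} = 1) \<and>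
      (\<forall>v\<in>Range B. card {e \<in> parcs F. snd e = v} = 1)"
  proof -
    have "in_arcs H v \<noteq> {} \<longleftrightarrow> v \<in> Range B" "out_arcs H v \<noteq> {} \<longleftrightarrow> v \<in> Domain B" for v
      by (force simp: in_arcs_def out_arcs_def parcs_H)+
    then show ?thesis
      unfolding pverts_H by (simp add: in_degree_def out_degree_def in_arcs_def out_arcs_def) blast
  qed
  ultimately show ?thesis
    unfolding is_factor_def
    using card_fibre_fst_iff[of "parcs F" B] card_fibre_snd_iff[of "parcs F" B]
    by blast
qed

text \<open>Connects the definitions on digraphs with the relational ones. The nonempty entry set
  required of a route is recovered from \<open>ents_nonempty\<close>.\<close>

lemma open_routes_iff:
  "r \<in> open_routes H \<longleftrightarrow> r \<in> extensional ents \<and> (\<exists>f. open_factor f \<and> route_of f r)"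
proof -
  have F: "is_open F \<longleftrightarrow> acyclic (parcs F)"
      "(\<forall>u\<in>entries H. \<exists>p. pre_digraph.apath F u p (r u)) \<longleftrightarrow> (\<forall>u\<in>ents. (u, r u) \<in> (parcs F)\<^sup>*)"
    if "is_factor F H" for F
  proof -
    have *: "pverts F = Domain B \<union> Range B" "parcs F \<subseteq> B"
      using that by (simp_all add: is_factor_iff pverts_H)
    have wf: "parcs F \<subseteq> pverts F \<times> pverts F"
      unfolding *(1) using *(2) by auto
    have V: "ents \<subseteq> pverts F" unfolding *(1) ents_def by blast
    show "is_open F \<longleftrightarrow> acyclic (parcs F)"
      unfolding is_open_def cycle_exists_iff[OF wf] by simp
    show "(\<forall>u\<in>entries H. \<exists>p. pre_digraph.apath F u p (r u)) \<longleftrightarrow> (\<forall>u\<in>ents. (u, r u) \<in> (parcs F)\<^sup>*)"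
      using V apath_exists_iff[OF wf] unfolding H_special_verts by blast
  qed
  show ?thesis
  proof
    assume "r \<in> open_routes H"
    then obtain F where "is_factor F H" "is_open F" "defines_route H F r"
      by (auto simp: open_routes_def)
    then have "open_factor (parcs F)" "route_of (parcs F) r" "r \<in> extensional ents"
      using F[of F]
      by (simp_all add: is_factor_iff open_factor_def route_of_def defines_route_def H_special_verts)
    then show "r \<in> extensional ents \<and> (\<exists>f. open_factor f \<and> route_of f r)" by blast
  next
    assume "r \<in> extensional ents \<and> (\<exists>f. open_factor f \<and> route_of f r)"
    then obtain f where f: "r \<in> extensional ents" "open_factor f" "route_of f r" by blast
    let ?F = "\<lparr>pverts = pverts H, parcs = f\<rparr>"
    have "is_factor ?F H"
      using f(2) by (simp add: is_factor_iff open_factor_def)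
    moreover from F[OF this] have "is_open ?F" "defines_route H ?F r"
      using f ents_nonempty[OF f(2) B_nonempty]
      by (simp_all add: open_factor_def route_of_def defines_route_def H_special_verts)
    ultimately show "r \<in> open_routes H" by (auto simp: open_routes_def)
  qed
qed

lemma hamiltonian_quotientI:
  assumes "hamiltonian G"
  shows "hamiltonian_quotient G K"
proof -
  obtain P where P: "P \<subseteq> B \<union> D" "spanning_cycle vertices P"
    using hamiltonianE[OF assms] unfolding vertices_eq parcs_eq by blast
  have f: "open_factor (P \<inter> B)" using open_factor_of_spanning_cycle[OF P D_nonempty] .
  obtain r where r: "r \<in> extensional ents" "route_of (P \<inter> B) r" using route_exists[OF f] .
  obtain Q where "Q \<subseteq> minor_arcs r" "single_valued Q" "minor_verts r \<times> minor_verts r \<subseteq> Q\<^sup>+"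
    using contract_spanning_cycle[OF P f r(2)] .
  moreover have "minor_verts r \<noteq> {}" using D_nonempty by (auto simp: minor_verts_def)
  ultimately have "hamiltonian (minor G K r)"
    using hamiltonianI[OF minor_wf] by (simp add: minor_eq)
  moreover have "r \<in> open_routes H" using f r open_routes_iff by blast
  ultimately show ?thesis by (auto simp: hamiltonian_quotient_def quotient_def)
qed

lemma hamiltonian_quotientD:
  assumes "hamiltonian_quotient G K"
  shows "hamiltonian G"
proof -
  from assms obtain r where r: "r \<in> open_routes H" "hamiltonian (minor G K r)"
    by (auto simp: hamiltonian_quotient_def quotient_def)
  then obtain f where f: "open_factor f" "route_of f r" using open_routes_iff by blast
  obtain P where "P \<subseteq> minor_arcs r" "spanning_cycle (minor_verts r) P"
    using hamiltonianE[OF r(2)] by (auto simp: minor_eq)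
  then obtain Q where "Q \<subseteq> B \<union> D" "single_valued Q" "vertices \<times> vertices \<subseteq> Q\<^sup>+"
    using lift_spanning_cycle[OF f, of P] by (auto simp: spanning_cycle_def)
  moreover have "vertices \<noteq> {}" using B_nonempty by (auto simp: vertices_def)
  ultimately show ?thesis
    using hamiltonianI[OF two_ddD(2)[OF two_dd], of Q] unfolding vertices_eq parcs_eq by blast
qed

end

section \<open>Model digraphs and non-Hamiltonicity\<close>

lemma digraph_iso_pairE:
  assumes "digraph_iso (with_proj H) (with_proj M)"
  obtains h where "inj_on h (pverts H)" "pverts M = h ` pverts H" "parcs M = map_prod h h ` parcs H"
proof -
  obtain f where f: "pre_digraph.digraph_isomorphism (with_proj H) f"
    "with_proj M = app_iso f (with_proj H)"
    using assms by (auto simp: digraph_iso_def)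
  have M: "pverts M = iso_verts f ` pverts H" "parcs M = iso_arcs f ` parcs H"
    "iso_tail f = fst" "iso_head f = snd"
    using arg_cong[OF f(2), of verts] arg_cong[OF f(2), of arcs]
      arg_cong[OF f(2), of tail] arg_cong[OF f(2), of head] by simp_all
  \<comment> \<open>A library isomorphism has its own arc map, but with \<open>fst\<close> and
    \<open>snd\<close> as tail and head on both sides, the vertex map determines it.\<close>
  have "iso_arcs f e = map_prod (iso_verts f) (iso_verts f) e" if "e \<in> parcs H" for e
    using f(1) that M(3,4)
    by (auto simp: pre_digraph.digraph_isomorphism_def prod_eq_iff)
  then have "parcs M = map_prod (iso_verts f) (iso_verts f) ` parcs H"
    unfolding M(2) by (rule image_cong[OF refl])
  moreover have "inj_on (iso_verts f) (pverts H)"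
    using f(1) by (simp add: pre_digraph.digraph_isomorphism_def)
  ultimately show ?thesis using that M(1) by blast
qed

text \<open>The direction from model to subgraph is wanted, in order to name the vertices of an
  alternating cycle after those of its model.\<close>

lemma digraph_iso_inverse_pairE:
  assumes "digraph_iso (with_proj H) (with_proj M)" "parcs H \<subseteq> pverts H \<times> pverts H"
  obtains g where "inj_on g (pverts M)" "g ` pverts M = pverts H" "parcs H = map_prod g g ` parcs M"
proof -
  obtain h where h: "inj_on h (pverts H)" "pverts M = h ` pverts H" "parcs M = map_prod h h ` parcs H"
    using digraph_iso_pairE[OF assms(1)] .
  let ?g = "inv_into (pverts H) h"
  have "map_prod ?g ?g (map_prod h h e) = e" if "e \<in> parcs H" for e
    using that assms(2) h(1) by (cases e) auto
  then have "map_prod ?g ?g ` map_prod h h ` parcs H = parcs H"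
    by (simp add: image_image)
  moreover have "inj_on ?g (pverts M)" "?g ` pverts M = pverts H"
    unfolding h(2) using h(1) by (simp_all add: inj_on_inv_into)
  ultimately show ?thesis using that h(3) by metis
qed

lemma spanning_cycle_closed:
  assumes "spanning_cycle V P" "x \<in> S" "x \<in> V" "\<And>a b. (a, b) \<in> P \<Longrightarrow> a \<in> S \<Longrightarrow> b \<in> S"
  shows "V \<subseteq> S"
proof
  fix y assume "y \<in> V"
  then have "(x, y) \<in> P\<^sup>+" using assms(1,3) by (auto simp: spanning_cycle_def)
  then show "y \<in> S" using assms(2,4) by (rule trancl_closed)
qed

text \<open>Every factor of either model contains a loop or a 2-cycle.\<close>

lemma two_dd_not_hamiltonian:
  assumes "two_dd G" "X \<in> alt_cycles G" "type_2L X \<or> type_1L1S X"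
  shows "\<not> hamiltonian G"
proof
  assume "hamiltonian G"
  then obtain P where P: "P \<subseteq> parcs G" "spanning_cycle (pverts G) P" by (rule hamiltonianE)
  have sv: "\<And>x y z. (x, y) \<in> P \<Longrightarrow> (x, z) \<in> P \<Longrightarrow> y = z"
    "\<And>x y z. (y, x) \<in> P \<Longrightarrow> (z, x) \<in> P \<Longrightarrow> y = z"
    using P(2) by (auto simp: spanning_cycle_def single_valued_def)
  have step: "\<exists>y. (x, y) \<in> P" "\<exists>y. (y, x) \<in> P" if "x \<in> pverts G" for x
  proof -
    have "(x, x) \<in> P\<^sup>+" using P(2) that by (auto simp: spanning_cycle_def)
    then show "\<exists>y. (x, y) \<in> P" "\<exists>y. (y, x) \<in> P" by (meson tranclE converse_tranclE)+
  qed
  have X: "alternation_closed (parcs G) X" "X \<subseteq> pverts G \<times> pverts G"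
    using alt_cycles_closed(1)[OF assms(1,2)] alternation_closedD(1) two_ddD(2)[OF assms(1)]
    by (blast, blast)
  \<comment> \<open>At a vertex where \<open>X\<close> has out-arcs or in-arcs, \<open>P\<close> can
    only use arcs of \<open>X\<close>.\<close>
  have P_X: "(a, b) \<in> X" if "(a, b) \<in> P" "a \<in> Domain X \<or> b \<in> Range X" for a b
  proof -
    from that(2) obtain e where "e \<in> X" "fst e = fst (a, b) \<or> snd e = snd (a, b)" by force
    then show ?thesis using alternation_closedD(2)[OF X(1), of e "(a, b)"] P(1) that(1) by blast
  qed
  have arcs_X: "parcs (ac_subgraph {X}) = X"
    "parcs (ac_subgraph {X}) \<subseteq> pverts (ac_subgraph {X}) \<times> pverts (ac_subgraph {X})"
    by (force simp: ac_subgraph_def)+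
  \<comment> \<open>A loop of \<open>P\<close> at \<open>x\<close> would make \<open>{x}\<close>
    closed under \<open>P\<close>, so \<open>y\<close> could not be reached.\<close>
  have no_loop: "(x, x) \<notin> P" if "x \<in> pverts G" "y \<in> pverts G" "x \<noteq> y" for x y
    using spanning_cycle_closed[OF P(2), of x "{x}"] sv(1) that by blast
  from assms(3) show False
  proof
    assume "type_2L X"
    then obtain g where g: "inj_on g (pverts model_2L)" "X = map_prod g g ` parcs model_2L"
      unfolding type_2L_def using digraph_iso_inverse_pairE[OF _ arcs_X(2)] arcs_X(1) by metis
    obtain a b c d where abcd: "distinct [a, b, c, d]"
      and X_eq: "X = {(a, b), (b, d), (c, c), (b, b), (c, d), (a, c)}"
      using that[of "g 1" "g 2" "g 3" "g 4"] g by (auto simp: model_2L_def)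
    have V: "a \<in> pverts G" "b \<in> pverts G" "c \<in> pverts G" using X(2) X_eq by auto
    obtain x y where "(x, b) \<in> P" "(y, c) \<in> P" using step V by meson
    then have "(x, b) \<in> X" "(y, c) \<in> X" using P_X X_eq by blast+
    moreover have "(b, b) \<notin> P" "(c, c) \<notin> P" using no_loop V abcd by auto
    \<comment> \<open>Without the loops, \<open>b\<close> and \<open>c\<close> can be entered only
      from \<open>a\<close>, which would then have two out-arcs in \<open>P\<close>.\<close>
    ultimately have "(a, b) \<in> P" "(a, c) \<in> P"
      using \<open>(x, b) \<in> P\<close> \<open>(y, c) \<in> P\<close> X_eq abcd by auto
    then show False using sv(1) abcd by auto
  next
    assume "type_1L1S X"
    then obtain g where g: "inj_on g (pverts model_1L1S)" "X = map_prod g g ` parcs model_1L1S"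
      unfolding type_1L1S_def using digraph_iso_inverse_pairE[OF _ arcs_X(2)] arcs_X(1) by metis
    obtain a b c d where abcd: "distinct [a, b, c, d]"
      and X_eq: "X = {(a, b), (c, d), (b, a), (a, a), (c, b), (b, d)}"
      using that[of "g 1" "g 2" "g 3" "g 4"] g by (auto simp: model_1L1S_def)
    have V: "a \<in> pverts G" "b \<in> pverts G" "c \<in> pverts G" using X(2) X_eq by auto
    obtain x y where xy: "(a, x) \<in> P" "(y, a) \<in> P" using step V by meson
    then have "(a, x) \<in> X" "(y, a) \<in> X" using P_X X_eq by blast+
    moreover have "(a, a) \<notin> P" using no_loop V abcd by auto
    \<comment> \<open>Without the loop, \<open>a\<close> can be left only to \<open>b\<close> and
      entered only from \<open>b\<close>; this 2-cycle misses \<open>c\<close>.\<close>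
    ultimately have "(a, b) \<in> P" "(b, a) \<in> P"
      using xy X_eq abcd by auto
    then have "pverts G \<subseteq> {a, b}"
      using spanning_cycle_closed[OF P(2), of a "{a, b}"] sv(1) V by blast
    then show False using V abcd by auto
  qed
qed

theorem theorem4:
  fixes G :: "'a pair_pre_digraph"
  assumes "two_dd G"
  shows
    "((hamiltonian G \<longrightarrow>
         (\<forall>K. K \<noteq> {} \<and> K \<subset> alt_cycles G \<longrightarrow> hamiltonian_quotient G K)) \<and>
      ((\<exists>K. K \<noteq> {} \<and> K \<subset> alt_cycles G \<and> hamiltonian_quotient G K) \<longrightarrow> hamiltonian G)) \<and>
     (\<forall>K r. K \<noteq> {} \<and> K \<subset> alt_cycles G \<and> open_routes (ac_subgraph K) = {r} \<longrightarrow>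
        (hamiltonian (minor G K r) \<longleftrightarrow> hamiltonian G)) \<and>
     ((\<forall>X \<in> alt_cycles G. card X = 6) \<and> (\<exists>X \<in> alt_cycles G. type_2L X \<or> type_1L1S X) \<longrightarrow>
        \<not> hamiltonian G)"
proof -
  have quotient_iff: "hamiltonian_quotient G K \<longleftrightarrow> hamiltonian G"
    if "K \<noteq> {}" "K \<subset> alt_cycles G" for K
  proof -
    interpret two_dd_split G K using assms that by unfold_locales
    show ?thesis using hamiltonian_quotientI hamiltonian_quotientD by blast
  qed
  \<comment> \<open>With a single open route the quotient has this minor as its only
    element.\<close>
  have minor_iff: "hamiltonian (minor G K r) \<longleftrightarrow> hamiltonian G"
    if "K \<noteq> {}" "K \<subset> alt_cycles G" "open_routes (ac_subgraph K) = {r}" for K r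
    using quotient_iff[OF that(1,2)] that(3) by (simp add: hamiltonian_quotient_def quotient_def)
  show ?thesis
  proof (intro conjI allI impI)
    show "hamiltonian_quotient G K" if "hamiltonian G" "K \<noteq> {} \<and> K \<subset> alt_cycles G" for K
      using quotient_iff that by simp
    show "hamiltonian G"
      if "\<exists>K. K \<noteq> {} \<and> K \<subset> alt_cycles G \<and> hamiltonian_quotient G K"
      using quotient_iff that by auto
    show "hamiltonian (minor G K r) \<longleftrightarrow> hamiltonian G"
      if "K \<noteq> {} \<and> K \<subset> alt_cycles G \<and> open_routes (ac_subgraph K) = {r}" for K r
      using minor_iff that by simp
    show "\<not> hamiltonian G"
      if "(\<forall>X \<in> alt_cycles G. card X = 6) \<and> (\<exists>X \<in> alt_cycles G. type_2L X \<or> type_1L1S X)"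
      using two_dd_not_hamiltonian[OF assms] that by auto
  qed
qed

end
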